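(* Let $A:\mathbb{Z}\to\mathbb{R}^{d\times d}$ satisfy: $A(n)$ is invertible for every $n\in\mathbb{Z}$, $\sup_{n\in\mathbb{Z}}\|A(n)\|<+\infty$ and $\sup_{n\in\mathbb{Z}}\|A^{-1}(n)\|<+\infty$. If the system $x(n+1)=A(n)x(n)$ has the full spectrum condition, then it is diagonalizable, i.e. it is kinematically similar to a system $y(n+1)=D(n)y(n)$ with $D(n)$ a diagonal matrix for every $n\in\mathbb{Z}$.
   Context: $\|\cdot\|$ is a matrix norm on $\mathbb{R}^{d\times d}$. Exponential dichotomy: Let $X(n)$ be the fundamental matrix of $x(n+1)=A(n)x(n)$ with $X(0)=I$, that is $X(n)=A(n-1)\cdots A(0)$ for $n\ge 1$ and $X(n)=A^{-1}(n)\cdots A^{-1}(-1)$ for $n\le -1$. The system has an exponential dichotomy on $\mathbb{Z}$ if there exist $K\ge 1$, $\rho\in(0,1)$ and a projector $P^2=P$ such that $\|X(n)PX(k)^{-1}\|\le K\rho^{n-k}$ for $n\ge k$ and $\|X(n)(I-P)X(k)^{-1}\|\le K\rho^{k-n}$ for $n\le k$. Spectrum: $\Sigma(A)$ is the set of $\lambda>0$ such that $x(n+1)=\lambda^{-1}A(n)x(n)$ does not have an exponential dichotomy on $\mathbb{Z}$. Full spectrum condition: $\Sigma(A)=[a_1,b_1]\cup[a_2,b_2]\cup\cdots\cup[a_d,b_d]$ is the union of exactly $d$ disjoint closed intervals, with $0<a_1\le b_1<a_2\le b_2<\cdots<a_d\le b_d$, where $d$ is the dimension of the system. Kinematic similarity: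 $x(n+1)=A(n)x(n)$ is kinematically similar to $y(n+1)=U(n)y(n)$ if there exists an invertible matrix function $n\mapsto F(n)$ with $\sup_{n\in\mathbb{Z}}\|F(n)\|<+\infty$ and $\sup_{n\in\mathbb{Z}}\|F^{-1}(n)\|<+\infty$ such that the change of coordinates $y(n)=F^{-1}(n)x(n)$ transforms the first system into the second. *)

theory Defs
  imports "HOL-Analysis.Analysis"
begin

type_synonym 'd system = "int \<Rightarrow> real^'d^'d"

(* The norm on matrices is an arbitrary one, passed as a parameter N: the library constant norm
   on real^'d^'d is only the Frobenius norm. Submultiplicativity is deliberately not required,
   so both common meanings of "matrix norm" are covered. *)
definition matrix_norm :: "(real^'d^'d \<Rightarrow> real) \<Rightarrow> bool" where
  "matrix_norm N \<longleftrightarrow>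
     (\<forall>M. 0 \<le> N M) \<and>
     (\<forall>M. N M = 0 \<longleftrightarrow> M = 0) \<and>
     (\<forall>c M. N (c *\<^sub>R M) = \<bar>c\<bar> * N M) \<and>
     (\<forall>M M'. N (M + M') \<le> N M + N M')"

(* fundamental_fwd A m = A(m-1) ** ... ** A(0) *)
primrec fundamental_fwd :: "'d::finite system \<Rightarrow> nat \<Rightarrow> real^'d^'d" where
  "fundamental_fwd A 0 = mat 1"
| "fundamental_fwd A (Suc m) = A (int m) ** fundamental_fwd A m"

(* fundamental_bwd A m = A(-m)^{-1} ** ... ** A(-1)^{-1} *)
primrec fundamental_bwd :: "'d::finite system \<Rightarrow> nat \<Rightarrow> real^'d^'d" where
  "fundamental_bwd A 0 = mat 1"
| "fundamental_bwd A (Suc m) = matrix_inv (A (- int (Suc m))) ** fundamental_bwd A m"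

definition fundamental_matrix :: "'d::finite system \<Rightarrow> int \<Rightarrow> real^'d^'d" where
  "fundamental_matrix A n =
     (if 0 \<le> n then fundamental_fwd A (nat n) else fundamental_bwd A (nat (- n)))"

definition exponential_dichotomy :: "(real^'d^'d \<Rightarrow> real) \<Rightarrow> 'd::finite system \<Rightarrow> bool" where
  "exponential_dichotomy N A \<longleftrightarrow>
     (\<exists>K \<rho> P. 1 \<le> K \<and> 0 < \<rho> \<and> \<rho> < 1 \<and> P ** P = P \<and>
        (\<forall>n k. k \<le> n \<longrightarrow>
           N (fundamental_matrix A n ** P ** matrix_inv (fundamental_matrix A k))
             \<le> K * \<rho> powi (n - k)) \<and>
        (\<forall>n k. n \<le> k \<longrightarrow>
           N (fundamental_matrix A n ** (mat 1 - P) ** matrix_inv (fundamental_matrix A k))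
             \<le> K * \<rho> powi (k - n)))"

definition dichotomy_spectrum :: "(real^'d^'d \<Rightarrow> real) \<Rightarrow> 'd::finite system \<Rightarrow> real set" where
  "dichotomy_spectrum N A =
     {l. 0 < l \<and> \<not> exponential_dichotomy N (\<lambda>n. inverse l *\<^sub>R A n)}"

definition full_spectrum :: "(real^'d^'d \<Rightarrow> real) \<Rightarrow> 'd::finite system \<Rightarrow> bool" where
  "full_spectrum N A \<longleftrightarrow>
     (\<exists>a b :: nat \<Rightarrow> real.
        0 < a 1 \<and>
        (\<forall>i\<in>{1..CARD('d)}. a i \<le> b i) \<and>
        (\<forall>i\<in>{1..<CARD('d)}. b i < a (i + 1)) \<and>
        dichotomy_spectrum N A = (\<Union>i\<in>{1..CARD('d)}. {a i..b i}))"

definition solution :: "'d::finite system \<Rightarrow> (int \<Rightarrow> real^'d) \<Rightarrow> bool" where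
  "solution A x \<longleftrightarrow> (\<forall>n. x (n + 1) = A n *v x n)"

definition kinematically_similar ::
  "(real^'d^'d \<Rightarrow> real) \<Rightarrow> 'd::finite system \<Rightarrow> 'd system \<Rightarrow> bool" where
  "kinematically_similar N A U \<longleftrightarrow>
     (\<exists>F :: 'd system.
        (\<forall>n. invertible (F n)) \<and>
        bdd_above (range (\<lambda>n. N (F n))) \<and>
        bdd_above (range (\<lambda>n. N (matrix_inv (F n)))) \<and>
        (\<forall>x. solution A x \<longleftrightarrow> solution U (\<lambda>n. matrix_inv (F n) *v x n)))"

definition diagonal_matrix :: "real^'d^'d \<Rightarrow> bool" where
  "diagonal_matrix M \<longleftrightarrow> (\<forall>i j. i \<noteq> j \<longrightarrow> M $ i $ j = 0)"

definition diagonalizable :: "(real^'d^'d \<Rightarrow> real) \<Rightarrow> 'd::finite system \<Rightarrow> bool" where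
  "diagonalizable N A \<longleftrightarrow>
     (\<exists>D :: 'd system. (\<forall>n. diagonal_matrix (D n)) \<and> kinematically_similar N A D)"

end

theory Submission
  imports Defs
begin

text \<open>Choose points below, between and above the \<open>d\<close> spectral intervals; each carries a dichotomy
  with projector \<open>P i\<close>, \<open>0 \<le> i \<le> d\<close>. Comparing growth rates gives \<open>P i ** P j = P (min i j)\<close>,
  and \<open>P i = P (i - 1)\<close> would yield a dichotomy throughout the \<open>i\<close>-th interval. So the differences
  \<open>P i - P (i - 1)\<close> are \<open>d\<close> nonzero, mutually annihilating projectors, which splits the space into
  invariant lines. Normalized solutions along these lines are the columns of \<open>F n\<close>. No ranks need
  to be counted, since \<open>d\<close> vectors in distinct ranges are automatically a basis.\<close>

section \<open>Inverse matrices and bilinearity of products\<close>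

lemma matrix_inv:
  fixes M :: "real^'n^'n"
  assumes "invertible M"
  shows matrix_inv_right: "M ** matrix_inv M = mat 1"
    and matrix_inv_left: "matrix_inv M ** M = mat 1"
proof -
  have "M ** matrix_inv M = mat 1 \<and> matrix_inv M ** M = mat 1"
    unfolding matrix_inv_def by (rule someI_ex) (use assms in \<open>simp add: invertible_def\<close>)
  then show "M ** matrix_inv M = mat 1" "matrix_inv M ** M = mat 1" by auto
qed

lemma matrix_inv_unique:
  fixes M :: "real^'n^'n"
  assumes "M ** M' = mat 1"
  shows "matrix_inv M = M'"
proof -
  have "invertible M" using assms invertible_right_inverse by blast
  then have "matrix_inv M = matrix_inv M ** (M ** M')" "matrix_inv M ** M = mat 1"
    by (simp_all add: assms matrix_inv)
  then show ?thesis by (simp add: matrix_mul_assoc)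
qed

lemma invertible_matrix_inv:
  fixes M :: "real^'n^'n"
  shows "invertible M \<Longrightarrow> invertible (matrix_inv M)"
  using matrix_inv_left invertible_right_inverse by blast

text \<open>Besides the algebraic rules collected below, this supplies the constant \<open>B\<close>
  for estimating products: \<open>N\<close> need not be submultiplicative, so such estimates are
  made in the Euclidean norm.\<close>

lemma bounded_bilinear_matrix_mult:
  "bounded_bilinear ((**) :: real^'n^'m \<Rightarrow> real^'k^'n \<Rightarrow> real^'k^'m)"
  unfolding bilinear_conv_bounded_bilinear[symmetric] bilinear_def linear_iff
  by (auto simp: vec_eq_iff matrix_matrix_mult_def sum.distrib sum_distrib_left algebra_simps)

lemma bounded_bilinear_matrix_vector_mult:
  "bounded_bilinear ((*v) :: real^'n^'m \<Rightarrow> real^'n \<Rightarrow> real^'m)"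
  unfolding bilinear_conv_bounded_bilinear[symmetric] bilinear_def linear_iff
  by (auto simp: vec_eq_iff matrix_vector_mult_def sum.distrib sum_distrib_left algebra_simps)

lemmas matrix_mult_bilinear =
  bounded_bilinear.diff_left[OF bounded_bilinear_matrix_mult]
  bounded_bilinear.diff_right[OF bounded_bilinear_matrix_mult]
  bounded_bilinear.scaleR_left[OF bounded_bilinear_matrix_mult]
  bounded_bilinear.scaleR_right[OF bounded_bilinear_matrix_mult]
  bounded_bilinear.zero_left[OF bounded_bilinear_matrix_mult]
  bounded_bilinear.zero_right[OF bounded_bilinear_matrix_mult]

lemma matrix_inv_scaleR:
  fixes M :: "real^'n^'n"
  assumes "c \<noteq> 0" "invertible M"
  shows "matrix_inv (c *\<^sub>R M) = inverse c *\<^sub>R matrix_inv M"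
  by (rule matrix_inv_unique) (simp add: matrix_mult_bilinear assms matrix_inv)

section \<open>Equivalence of an arbitrary matrix norm with the Euclidean one\<close>

lemma norm_matrix_le_sum_abs:
  fixes M :: "real^'n^'m"
  shows "norm M \<le> (\<Sum>i\<in>UNIV. \<Sum>j\<in>UNIV. \<bar>M$i$j\<bar>)"
proof -
  have "norm M \<le> (\<Sum>i\<in>UNIV. norm (M$i))"
    unfolding norm_vec_def by (rule L2_set_le_sum) simp
  also have "\<dots> \<le> (\<Sum>i\<in>UNIV. \<Sum>j\<in>UNIV. \<bar>M$i$j\<bar>)"
    by (intro sum_mono norm_le_l1_cart)
  finally show ?thesis .
qed

text \<open>Expansion in an orthonormal basis and the triangle inequality give the bound; the
  summand 1 in \<open>?C\<close> makes the constant visibly positive.\<close>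

lemma matrix_norm_le_norm:
  fixes N :: "real^'d^'d \<Rightarrow> real"
  assumes "matrix_norm N"
  obtains C where "0 < C" "\<And>M. N M \<le> C * norm M"
proof
  let ?C = "1 + (\<Sum>b\<in>Basis. N b)"
  have N: "0 \<le> N M" "N M = 0 \<longleftrightarrow> M = 0" "N (c *\<^sub>R M) = \<bar>c\<bar> * N M" "N (M + M') \<le> N M + N M'"
    for c M M' using assms by (auto simp: matrix_norm_def)
  have N0: "N 0 = 0" using N(2)[of 0] by simp
  have sum: "N (\<Sum>b\<in>B. f b) \<le> (\<Sum>b\<in>B. N (f b))" if "finite B"
    for B and f :: "real^'d^'d \<Rightarrow> real^'d^'d"
    using that by induction (auto simp: N0 intro: order_trans[OF N(4)])
  show "0 < ?C" by (simp add: N sum_nonneg add_pos_nonneg)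
  fix M :: "real^'d^'d"
  have "N M = N (\<Sum>b\<in>Basis. (M \<bullet> b) *\<^sub>R b)" by (simp add: euclidean_representation)
  also have "\<dots> \<le> (\<Sum>b\<in>Basis. \<bar>M \<bullet> b\<bar> * N b)"
    using sum[of Basis "\<lambda>b. (M \<bullet> b) *\<^sub>R b"] by (simp add: N)
  also have "\<dots> \<le> (\<Sum>b\<in>Basis. norm M * N b)"
    by (intro sum_mono mult_right_mono Basis_le_norm N)
  also have "\<dots> \<le> ?C * norm M" by (simp add: sum_distrib_left algebra_simps)
  finally show "N M \<le> ?C * norm M" .
qed

text \<open>Compactness argument: by the upper bound \<open>N\<close> is Lipschitz, so it attains a
  minimum on the unit sphere. Definiteness makes this minimum positive, and homogeneity carries the
  estimate to all matrices.\<close>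

lemma norm_le_matrix_norm:
  fixes N :: "real^'d^'d \<Rightarrow> real"
  assumes "matrix_norm N"
  obtains c where "0 < c" "\<And>M. norm M \<le> c * N M"
proof -
  have N: "0 \<le> N M" "N M = 0 \<longleftrightarrow> M = 0" "N (c *\<^sub>R M) = \<bar>c\<bar> * N M" "N (M + M') \<le> N M + N M'"
    for c M M' using assms by (auto simp: matrix_norm_def)
  have N0: "N 0 = 0" using N(2)[of 0] by simp
  obtain C where C: "0 < C" "\<And>M. N M \<le> C * norm M" using matrix_norm_le_norm[OF assms] by blast
  have "\<bar>N M - N M'\<bar> \<le> C * norm (M - M')" for M M'
    using N(4)[of "M - M'" M'] N(4)[of "M' - M" M] C(2)[of "M - M'"] C(2)[of "M' - M"]
    by (simp add: norm_minus_commute)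
  then have "C-lipschitz_on (sphere 0 1) N"
    using C(1) by (intro lipschitz_onI) (auto simp: dist_norm)
  then have "continuous_on (sphere 0 1) N" by (rule lipschitz_on_continuous_on)
  moreover have "sphere (0 :: real^'d^'d) 1 \<noteq> {}" by simp
  ultimately obtain S where S: "S \<in> sphere 0 1" "\<And>M. M \<in> sphere 0 1 \<Longrightarrow> N S \<le> N M"
    using continuous_attains_inf[OF compact_sphere] by metis
  have pos: "0 < N S" using N(1)[of S] N(2)[of S] S(1) by (auto simp: less_le)
  show thesis
  proof
    show "0 < inverse (N S)" using pos by simp
    fix M :: "real^'d^'d"
    show "norm M \<le> inverse (N S) * N M"
    proof (cases "M = 0")
      case False
      then have "N S \<le> N (inverse (norm M) *\<^sub>R M)" by (intro S(2)) simp
      then show ?thesis using False pos by (simp add: N field_simps)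
    qed (simp add: N0)
  qed
qed

section \<open>Fundamental matrices\<close>

lemma invertible_fundamental_matrix:
  fixes A :: "'d::finite system"
  assumes "\<And>n. invertible (A n)"
  shows "invertible (fundamental_matrix A n)"
proof -
  have "invertible (mat 1 :: real^'d^'d)" using invertible_right_inverse by fastforce
  then have "invertible (fundamental_fwd A m)" "invertible (fundamental_bwd A m)" for m
    by (induction m) (auto intro!: invertible_mult invertible_matrix_inv assms)
  then show ?thesis by (simp add: fundamental_matrix_def)
qed

lemma fundamental_matrix_Suc:
  fixes A :: "'d::finite system"
  assumes "\<And>n. invertible (A n)"
  shows "fundamental_matrix A (n + 1) = A n ** fundamental_matrix A n"
proof (cases "0 \<le> n")
  case True
  then have "nat (n + 1) = Suc (nat n)" by simp
  then show ?thesis using True by (simp add: fundamental_matrix_def)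
next
  case False
  define m where "m = nat (- n - 1)"
  have n: "n = - int (Suc m)" using False by (simp add: m_def)
  have "nat (- n) = Suc m" "nat (- (n + 1)) = m" by (simp_all add: n)
  moreover have "fundamental_matrix A (n + 1) = fundamental_bwd A m"
    \<comment> \<open>For \<open>m = 0\<close> the index \<open>n + 1 = 0\<close> falls under the
      forward branch; both branches are the identity there.\<close>
    by (cases "m = 0") (simp_all add: fundamental_matrix_def n)
  ultimately show ?thesis using False
    by (simp add: fundamental_matrix_def matrix_mul_assoc n[symmetric] matrix_inv assms del: of_nat_Suc)
qed

section \<open>Rescaled systems and their dichotomies\<close>

lemma fundamental_matrix_scaleR:
  fixes A :: "'d::finite system"
  assumes "\<And>n. invertible (A n)" "l > 0"
  shows "fundamental_matrix (\<lambda>n. inverse l *\<^sub>R A n) n = l powi (- n) *\<^sub>R fundamental_matrix A n"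
proof -
  have "fundamental_fwd (\<lambda>n. inverse l *\<^sub>R A n) m = inverse l ^ m *\<^sub>R fundamental_fwd A m" for m
    by (induction m) (simp_all add: matrix_mult_bilinear)
  moreover have "fundamental_bwd (\<lambda>n. inverse l *\<^sub>R A n) m = l ^ m *\<^sub>R fundamental_bwd A m" for m
    using assms by (induction m) (simp_all add: matrix_mult_bilinear matrix_inv_scaleR)
  ultimately show ?thesis
    by (simp add: fundamental_matrix_def power_int_def)
qed

text \<open>The dichotomy of the system scaled by \<^term>\<open>inverse l\<close>, expressed through the unscaled
  evolution \<open>X\<close>.\<close>

definition dichotomy_at ::
  "(real^'d^'d \<Rightarrow> real) \<Rightarrow> (int \<Rightarrow> real^'d^'d) \<Rightarrow> real \<Rightarrow> real^'d^'d \<Rightarrow> bool" where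
  "dichotomy_at N X l P \<longleftrightarrow>
     (\<exists>K \<rho>. 1 \<le> K \<and> 0 < \<rho> \<and> \<rho> < 1 \<and> P ** P = P \<and>
        (\<forall>n k. k \<le> n \<longrightarrow> N (X n ** P ** matrix_inv (X k)) \<le> K * (\<rho> * l) powi (n - k)) \<and>
        (\<forall>n k. n \<le> k \<longrightarrow> N (X n ** (mat 1 - P) ** matrix_inv (X k)) \<le> K * (\<rho> / l) powi (k - n)))"

text \<open>Rescaling multiplies each evolution operator by \<open>l powi (k - n)\<close>. This
  factor is absorbed into the rate, which becomes \<open>\<rho> * l\<close> forwards and
  \<open>\<rho> / l\<close> backwards, while the projector stays the same.\<close>

lemma exponential_dichotomy_scaleR_iff:
  fixes A :: "'d::finite system"
  assumes "matrix_norm N" "\<And>n. invertible (A n)" "l > 0"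
  shows "exponential_dichotomy N (\<lambda>n. inverse l *\<^sub>R A n) \<longleftrightarrow>
    (\<exists>P. dichotomy_at N (fundamental_matrix A) l P)"
proof -
  let ?X = "fundamental_matrix A"
  let ?Y = "fundamental_matrix (\<lambda>n. inverse l *\<^sub>R A n)"
  have N: "N (?Y n ** M ** matrix_inv (?Y k)) = l powi (k - n) * N (?X n ** M ** matrix_inv (?X k))"
    for M n k
  proof -
    have "?Y n ** M ** matrix_inv (?Y k) =
        (l powi (- n) * inverse (l powi (- k))) *\<^sub>R (?X n ** M ** matrix_inv (?X k))"
      using assms by (simp add: fundamental_matrix_scaleR matrix_inv_scaleR
          invertible_fundamental_matrix matrix_mult_bilinear mult.commute)
    also have "l powi (- n) * inverse (l powi (- k)) = l powi (k - n)"
      using assms(3) by (simp add: power_int_diff power_int_minus divide_simps)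
    finally show ?thesis using assms(1,3) by (simp add: matrix_norm_def)
  qed
  have fwd: "l powi (k - n) * x \<le> K * \<rho> powi (n - k) \<longleftrightarrow> x \<le> K * (\<rho> * l) powi (n - k)"
    for x K \<rho> :: real and n k
  proof -
    have "l powi (k - n) = inverse (l powi (n - k))" using power_int_minus[of l "n - k"] by simp
    moreover have "0 < l powi (n - k)" using assms(3) by simp
    ultimately show ?thesis unfolding power_int_mult_distrib
      by (metis inverse_eq_divide mult.assoc mult.commute pos_divide_le_eq times_divide_eq_left mult_1)
  qed
  have bwd: "l powi (k - n) * x \<le> K * \<rho> powi (k - n) \<longleftrightarrow> x \<le> K * (\<rho> / l) powi (k - n)"
    for x K \<rho> :: real and n k
    using assms(3) by (simp add: power_int_divide_distrib divide_simps mult_ac)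
  show ?thesis
    unfolding exponential_dichotomy_def dichotomy_at_def N fwd bwd by blast
qed

section \<open>Comparing dichotomies at different rates\<close>

lemma le_geometric_imp_le_0:
  fixes x C r :: real
  assumes "\<And>j. x \<le> C * r ^ j" "0 \<le> r" "r < 1"
  shows "x \<le> 0"
proof -
  have "(\<lambda>j. C * r ^ j) \<longlonglongrightarrow> C * 0"
    using assms by (intro tendsto_intros LIMSEQ_power_zero) simp
  then show ?thesis using assms(1) by (intro LIMSEQ_le_const[of _ "0" x]) auto
qed

text \<open>The first identity says that the range of \<open>P\<close> lies in that of
  \<open>Q\<close>, the second that the kernel of \<open>Q\<close> lies in that of \<open>P\<close>.
  Solutions bounded by the slower rate \<open>l\<close> cannot have a component that grows faster
  than \<open>m\<close>; the two identities come from letting time tend to plus and to minus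
  infinity.\<close>

lemma dichotomy_at_nested:
  fixes X :: "int \<Rightarrow> real^'d^'d"
  assumes N: "matrix_norm N" and X: "\<And>n. invertible (X n)" "X 0 = mat 1"
    and l: "0 < l" "l < m" and P: "dichotomy_at N X l P" and Q: "dichotomy_at N X m Q"
  shows "Q ** P = P" and "P ** Q = P"
proof -
  obtain K \<rho> where K: "1 \<le> K" "0 < \<rho>" "\<rho> < 1"
    and Pb: "\<And>n k. k \<le> n \<Longrightarrow> N (X n ** P ** matrix_inv (X k)) \<le> K * (\<rho> * l) powi (n - k)"
    using P unfolding dichotomy_at_def by blast
  obtain L \<sigma> where L: "1 \<le> L" "0 < \<sigma>" "\<sigma> < 1"
    and Qb: "\<And>n k. n \<le> k \<Longrightarrow> N (X n ** (mat 1 - Q) ** matrix_inv (X k)) \<le> L * (\<sigma> / m) powi (k - n)"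
    using Q unfolding dichotomy_at_def by blast
  obtain c where c: "0 < c" "\<And>M. norm M \<le> c * N M" using norm_le_matrix_norm[OF N] by blast
  obtain B where B: "0 < B" "\<And>(M :: real^'d^'d) (M' :: real^'d^'d). norm (M ** M') \<le> norm M * norm M' * B"
    using bounded_bilinear.pos_bounded[OF bounded_bilinear_matrix_mult] by blast
  \<comment> \<open>The combined rate of a forward estimate for \<open>P\<close> and a backward one
    for \<open>mat 1 - Q\<close>; it is below 1 because \<open>\<rho> * \<sigma> < 1\<close> and
    \<open>l < m\<close>.\<close>
  define r where "r = (\<rho> * l) * (\<sigma> / m)"
  have inv0: "matrix_inv (mat 1 :: real^'d^'d) = mat 1" by (rule matrix_inv_unique) simp
  have "\<rho> * \<sigma> < 1" using K L mult_strict_mono[of \<rho> 1 \<sigma> 1] by simp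
  moreover have "l / m < 1" "0 < l / m" using l by simp_all
  ultimately have "(\<rho> * \<sigma>) * (l / m) < 1" using K L mult_strict_mono[of "\<rho> * \<sigma>" 1 "l / m" 1] by simp
  then have r: "0 \<le> r" "r < 1" using K L l by (simp_all add: r_def mult_ac)
  \<comment> \<open>Inserting \<open>matrix_inv (Y j) ** Y j\<close> between the factors bounds the
    fixed matrix \<open>M ** M'\<close> by a multiple of \<open>r ^ j\<close> for every
    \<open>j\<close>. \<open>Y\<close> is left general so as to run through either time
    direction.\<close>
  have zero: "M ** M' = 0"
    if b: "\<And>j. N (Y j ** M') \<le> H * s ^ j" "\<And>j. N (M ** matrix_inv (Y j)) \<le> H' * s' ^ j"
      and s: "s * s' = r" "0 < s" "0 < s'" and Y: "\<And>j. invertible (Y j)" "0 < H" "0 < H'"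
    for M M' :: "real^'d^'d" and Y H H' s s'
  proof -
    have "norm (M ** M') \<le> (c * H' * c * H * B) * r ^ j" for j
    proof -
      have "M ** M' = (M ** matrix_inv (Y j)) ** (Y j ** M')"
        by (metis Y(1) matrix_inv_left matrix_mul_assoc matrix_mul_rid)
      then have "norm (M ** M') \<le> norm (M ** matrix_inv (Y j)) * norm (Y j ** M') * B"
        by (rule ssubst) (rule B(2))
      also have "\<dots> \<le> (c * (H' * s' ^ j)) * (c * (H * s ^ j)) * B"
        using B(1) c(1) b[of j] s Y
        by (intro mult_right_mono mult_mono order_trans[OF c(2)] mult_left_mono) auto
      also have "\<dots> = (c * H' * c * H * B) * r ^ j"
        by (simp add: s(1)[symmetric] power_mult_distrib mult_ac)
      finally show ?thesis .
    qed
    then show ?thesis using le_geometric_imp_le_0[OF _ r] by fastforce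
  qed
  \<comment> \<open>Forward time: \<open>P\<close> is carried from 0 to \<open>j\<close>, and
    \<open>mat 1 - Q\<close> carries back from \<open>j\<close> to 0.\<close>
  have "(mat 1 - Q) ** P = 0"
    using Pb[of 0 "int _"] Qb[of 0 "int _"] K L l X
    by (intro zero[of "\<lambda>j. X (int j)" P K "\<rho> * l" _ L "\<sigma> / m"]) (auto simp: r_def inv0)
  then show "Q ** P = P" by (simp add: matrix_mult_bilinear)
  \<comment> \<open>Backward time: now \<open>mat 1 - Q\<close> is carried from 0 to
    \<open>-j\<close>, and \<open>P\<close> carries from \<open>-j\<close> to 0.\<close>
  have "P ** (mat 1 - Q) = 0"
    using Pb[of "- int _" 0] Qb[of "- int _" 0] K L l X
    by (intro zero[of "\<lambda>j. X (- int j)" _ L "\<sigma> / m" P K "\<rho> * l"]) (auto simp: r_def inv0)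
  then show "P ** Q = P" by (simp add: matrix_mult_bilinear)
qed

text \<open>Raising \<open>l\<close> to \<open>v\<close> weakens the forward estimate and lowering
  \<open>m\<close> to \<open>v\<close> weakens the backward one. Since the projector is common, both
  hold at \<open>v\<close> with the larger constants.\<close>

lemma dichotomy_at_between:
  assumes l: "0 < l" "l \<le> v" "v \<le> m"
    and P: "dichotomy_at N X l P" and Q: "dichotomy_at N X m P"
  shows "dichotomy_at N X v P"
proof -
  obtain K \<rho> where K: "1 \<le> K" "0 < \<rho>" "\<rho> < 1" "P ** P = P"
    and Kb: "\<And>n k. k \<le> n \<Longrightarrow> N (X n ** P ** matrix_inv (X k)) \<le> K * (\<rho> * l) powi (n - k)"
    using P unfolding dichotomy_at_def by blast
  obtain L \<sigma> where L: "1 \<le> L" "0 < \<sigma>" "\<sigma> < 1"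
    and Lb: "\<And>n k. n \<le> k \<Longrightarrow> N (X n ** (mat 1 - P) ** matrix_inv (X k)) \<le> L * (\<sigma> / m) powi (k - n)"
    using Q unfolding dichotomy_at_def by blast
  have fwd: "K * (\<rho> * l) powi (n - k) \<le> max K L * (max \<rho> \<sigma> * v) powi (n - k)" if "k \<le> n" for n k
    using that K l by (intro mult_mono power_int_mono) auto
  have bwd: "L * (\<sigma> / m) powi (k - n) \<le> max K L * (max \<rho> \<sigma> / v) powi (k - n)" if "n \<le> k" for n k
    using that L l by (intro mult_mono power_int_mono frac_le) auto
  show ?thesis unfolding dichotomy_at_def
  proof (rule exI[of _ "max K L"], rule exI[of _ "max \<rho> \<sigma>"], intro conjI allI impI)
    fix n k :: int
    show "N (X n ** P ** matrix_inv (X k)) \<le> max K L * (max \<rho> \<sigma> * v) powi (n - k)" if "k \<le> n"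
      using Kb[OF that] fwd[OF that] by (rule order_trans)
    show "N (X n ** (mat 1 - P) ** matrix_inv (X k)) \<le> max K L * (max \<rho> \<sigma> / v) powi (k - n)" if "n \<le> k"
      using Lb[OF that] bwd[OF that] by (rule order_trans)
  qed (use K L in auto)
qed

text \<open>The forward estimate at \<open>n = k\<close>, where the power is 1.\<close>

lemma dichotomy_at_bounded:
  fixes X :: "int \<Rightarrow> real^'d^'d"
  assumes "matrix_norm N" "dichotomy_at N X l P"
  shows "bounded (range (\<lambda>n. X n ** P ** matrix_inv (X n)))"
proof -
  obtain K \<rho> where
    b: "\<And>n k. k \<le> n \<Longrightarrow> N (X n ** P ** matrix_inv (X k)) \<le> K * (\<rho> * l) powi (n - k)"
    using assms unfolding dichotomy_at_def by blast
  obtain c where c: "0 < c" "\<And>M. norm M \<le> c * N M" using norm_le_matrix_norm[OF assms(1)] by blast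
  have "norm (X n ** P ** matrix_inv (X n)) \<le> c * K" for n
    using b[of n n] c(1) by (intro order_trans[OF c(2)] mult_left_mono) auto
  then show ?thesis unfolding bounded_iff by blast
qed

section \<open>Diagonalization along invariant lines\<close>

text \<open>The invariant lines \<open>X n (range (Q i))\<close> carry normalized vectors; boundedness of the
  projections onto them keeps the angles between the lines away from zero.\<close>

lemma diagonalizable_if_projections:
  fixes X :: "int \<Rightarrow> real^'d^'d" and Q :: "'d \<Rightarrow> real^'d^'d"
  assumes N: "matrix_norm N" and X: "\<And>n. invertible (X n)" "\<And>n. X (n + 1) = A n ** X n"
    and Q: "\<And>i. Q i \<noteq> 0" "\<And>i j. Q i ** Q j = (if i = j then Q i else 0)"
    and bdd: "\<And>i. bounded (range (\<lambda>n. X n ** Q i ** matrix_inv (X n)))"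
  shows "diagonalizable N A"
proof -
  have "\<exists>w. Q i *v w \<noteq> 0" for i
    using Q(1)[of i] by (metis matrix_eq matrix_vector_mult_0)
  then obtain w where w: "\<And>i. Q i *v w i \<noteq> 0" by metis
  \<comment> \<open>The solution that starts at a nonzero vector in the range of \<open>Q i\<close>;
    it never vanishes, so it can be normalized.\<close>
  define x where "x n i = X n *v (Q i *v w i)" for n i
  define u where "u n i = inverse (norm (x n i)) *\<^sub>R x n i" for n i
  define F where "F n = (\<chi> r c. u n c $ r)" for n
  \<comment> \<open>The entries are the one-step growth factors of these solutions.\<close>
  define D :: "'d system" where
    "D n = (\<chi> r c. if r = c then norm (x (n + 1) r) / norm (x n r) else 0)" for n
  \<comment> \<open>\<open>Q i\<close> transported to time \<open>n\<close>: it fixes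
    \<open>u n i\<close> and kills the other columns of \<open>F n\<close>, so it reads off the
    \<open>i\<close>-th coordinate.\<close>
  define S where "S n i = X n ** Q i ** matrix_inv (X n)" for n i
  have x: "x n i \<noteq> 0" for n i
    using w[of i] inj_matrix_vector_mult[OF X(1), of n] unfolding x_def
    by (metis injD matrix_vector_mult_0_right)
  have norm_u: "norm (u n i) = 1" for n i using x by (simp add: u_def)
  have "S n i *v x n j = X n *v ((Q i ** Q j) *v w j)" for n i j
    by (simp add: S_def x_def matrix_vector_mul_assoc)
      (metis X(1) matrix_inv_left matrix_mul_assoc matrix_mul_rid)
  then have S: "S n i *v u n j = (if i = j then u n j else 0)" for n i j
    by (simp add: u_def Q(2) x_def matrix_vector_mult_scaleR)
  have F: "F n *v c = (\<Sum>i\<in>UNIV. c$i *\<^sub>R u n i)" for n c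
    by (simp add: F_def vec_eq_iff matrix_vector_mult_def mult.commute)
  have SF: "S n i *v (F n *v c) = c$i *\<^sub>R u n i" for n i c
  proof -
    have "S n i *v (F n *v c) = (\<Sum>j\<in>UNIV. c$j *\<^sub>R (S n i *v u n j))"
      unfolding F by (simp add: bounded_bilinear.sum_right[OF bounded_bilinear_matrix_vector_mult]
          matrix_vector_mult_scaleR)
    also have "\<dots> = (\<Sum>j\<in>UNIV. if i = j then c$j *\<^sub>R u n j else 0)"
      by (intro sum.cong) (auto simp: S)
    finally show ?thesis by simp
  qed
  obtain B where B: "0 < B" "\<And>(M :: real^'d^'d) v. norm (M *v v) \<le> norm M * norm v * B"
    using bounded_bilinear.pos_bounded[OF bounded_bilinear_matrix_vector_mult] by blast
  have "\<forall>i. \<exists>b. \<forall>n. norm (S n i) \<le> b" using bdd unfolding bounded_iff S_def by blast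
  then obtain b where b: "\<And>n i. norm (S n i) \<le> b i" by metis
  \<comment> \<open>The key estimate, uniform in \<open>n\<close>: it yields injectivity of
    \<open>F n\<close> and also bounds the entries of its inverse.\<close>
  have coord: "\<bar>c$i\<bar> \<le> b i * norm (F n *v c) * B" for n i c
  proof -
    have "\<bar>c$i\<bar> = norm (S n i *v (F n *v c))" by (simp add: SF norm_u)
    also have "\<dots> \<le> norm (S n i) * norm (F n *v c) * B" by (rule B)
    also have "\<dots> \<le> b i * norm (F n *v c) * B" using B(1) b by (intro mult_right_mono) auto
    finally show ?thesis .
  qed
  have inv: "invertible (F n)" for n
  proof -
    have "c = 0" if "F n *v c = 0" for c
      using coord[of c _ n] that by (simp add: vec_eq_iff)
    then show ?thesis by (simp add: invertible_left_inverse matrix_left_invertible_ker)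
  qed
  have "norm (F n) \<le> (\<Sum>i\<in>(UNIV :: 'd set). \<Sum>j\<in>(UNIV :: 'd set). 1)" for n
    using component_le_norm_cart[of "u n _"]
    by (intro order_trans[OF norm_matrix_le_sum_abs] sum_mono) (simp add: F_def norm_u)
  then have F_bdd: "bounded (range F)" unfolding bounded_iff by blast
  have "norm (matrix_inv (F n)) \<le> (\<Sum>i\<in>(UNIV :: 'd set). \<Sum>j\<in>(UNIV :: 'd set). b i * B)" for n
  proof -
    have "\<bar>matrix_inv (F n) $ i $ j\<bar> \<le> b i * B" for i j
    proof -
      \<comment> \<open>\<open>coord\<close> is applied to the \<open>j\<close>-th column of the
        inverse, which \<open>F n\<close> maps to a unit vector.\<close>
      have "F n *v (matrix_inv (F n) *v axis j 1) = axis j 1"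
        by (simp only: matrix_vector_mul_assoc matrix_inv_right[OF inv] matrix_vector_mul_lid)
      moreover have "(matrix_inv (F n) *v axis j 1) $ i = matrix_inv (F n) $ i $ j"
        by (simp add: matrix_vector_mult_basis column_def)
      ultimately show ?thesis using coord[of "matrix_inv (F n) *v axis j 1" i n] by simp
    qed
    then show ?thesis
      by (intro order_trans[OF norm_matrix_le_sum_abs] sum_mono) simp
  qed
  then have inv_bdd: "bounded (range (\<lambda>n. matrix_inv (F n)))" unfolding bounded_iff by blast
  obtain C where C: "0 < C" "\<And>M. N M \<le> C * norm M" using matrix_norm_le_norm[OF N] by blast
  have N_bdd: "bdd_above (range (\<lambda>n. N (G n)))" if G: "bounded (range G)" for G :: "'d system"
  proof -
    obtain a where "\<And>n. norm (G n) \<le> a" using G unfolding bounded_iff by blast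
    then have "N (G n) \<le> C * a" for n using C(1) by (intro order_trans[OF C(2)] mult_left_mono) auto
    then show ?thesis by (intro bdd_aboveI2)
  qed
  have "A n *v u n i = (norm (x (n + 1) i) / norm (x n i)) *\<^sub>R u (n + 1) i" for n i
  proof -
    have "A n *v x n i = x (n + 1) i" by (simp add: x_def X(2) matrix_vector_mul_assoc matrix_mul_assoc)
    then show ?thesis using x[of "n + 1" i] x[of n i]
      by (simp add: u_def matrix_vector_mult_scaleR inverse_eq_divide)
  qed
  then have AF: "A n ** F n = F (n + 1) ** D n" for n
    by (simp add: vec_eq_iff F_def D_def matrix_matrix_mult_def matrix_vector_mult_def
        if_distrib[of "\<lambda>t. _ * t"] sum.delta mult.commute cong: if_cong)
  have "y (n + 1) = A n *v y n \<longleftrightarrow>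
      matrix_inv (F (n + 1)) *v y (n + 1) = D n *v (matrix_inv (F n) *v y n)" for y n
  proof -
    have "matrix_inv (F (n + 1)) ** A n = D n ** matrix_inv (F n)"
      by (metis AF inv matrix_inv_left matrix_inv_right matrix_mul_assoc matrix_mul_lid matrix_mul_rid)
    then have "D n *v (matrix_inv (F n) *v y n) = matrix_inv (F (n + 1)) *v (A n *v y n)"
      by (simp add: matrix_vector_mul_assoc)
    \<comment> \<open>Injectivity of the inverse at time \<open>n + 1\<close> gives the direction
      from the diagonal system back to \<open>A\<close>.\<close>
    then show ?thesis
      using inj_matrix_vector_mult[OF invertible_matrix_inv[OF inv], of "n + 1"]
      by (simp add: inj_eq)
  qed
  then have "kinematically_similar N A D"
    unfolding kinematically_similar_def solution_def
    using inv N_bdd F_bdd inv_bdd by (intro exI[of _ F]) auto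
  then show ?thesis unfolding diagonalizable_def
    by (intro exI[of _ D]) (auto simp: diagonal_matrix_def D_def)
qed

section \<open>Sample points in the spectral gaps\<close>

text \<open>Midpoints of the gaps serve, with \<open>a 1 / 2\<close> below the first interval and
  \<open>b d + 1\<close> above the last. Each point is compared with all intervals, so that it
  visibly avoids their union.\<close>

lemma interval_gap_points:
  fixes a b :: "nat \<Rightarrow> real"
  assumes "0 < a 1" "\<forall>i\<in>{1..d}. a i \<le> b i" "\<forall>i\<in>{1..<d}. b i < a (i + 1)"
  obtains l where "\<And>i. i \<le> d \<Longrightarrow> 0 < l i"
    and "\<And>i j. i \<le> d \<Longrightarrow> 1 \<le> j \<Longrightarrow> j \<le> i \<Longrightarrow> b j < l i"
    and "\<And>i j. i < j \<Longrightarrow> j \<le> d \<Longrightarrow> l i < a j"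
proof -
  define l where "l i = (if i = 0 then a 1 / 2 else if i < d then (b i + a (i + 1)) / 2 else b d + 1)" for i
  \<comment> \<open>Monotonicity of the endpoints extends comparisons with neighbouring intervals to
    all of them.\<close>
  have up: "a i \<le> a j \<and> b i \<le> b j" if "1 \<le> i" "i \<le> j" "j \<le> d" for i j
    using that(2,1,3)
  proof (induction j rule: dec_induct)
    case (step k)
    then have "a k \<le> b k" "b k < a (k + 1)" "a (k + 1) \<le> b (k + 1)" using assms by auto
    with step show ?case by auto
  qed simp
  have below: "b j < l i" if "i \<le> d" "1 \<le> j" "j \<le> i" for i j
  proof -
    have "b j \<le> b i" using up that by simp
    moreover have "b i < a (i + 1)" if "i < d" using assms that \<open>1 \<le> j\<close> \<open>j \<le> i\<close> by auto
    ultimately show ?thesis using that by (auto simp: l_def)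
  qed
  have above: "l i < a j" if "i < j" "j \<le> d" for i j
  proof -
    have "a (i + 1) \<le> a j" using up[of "i + 1" j] that by simp
    moreover have "b i < a (i + 1)" if "i \<noteq> 0" using assms that \<open>i < j\<close> \<open>j \<le> d\<close> by auto
    ultimately show ?thesis using that assms(1) by (auto simp: l_def)
  qed
  have "0 < l i" if "i \<le> d" for i
  proof (cases "i = 0")
    case False
    then have "a 1 \<le> a i" "a i \<le> b i" "b i < l i" using up[of 1 i] assms(2) that below[of i i] by auto
    then show ?thesis using assms(1) by simp
  qed (use assms(1) in \<open>simp add: l_def\<close>)
  with below above show thesis using that by blast
qed

section \<open>Projections attached to the spectral intervals\<close>

theorem theorem2:
  fixes N :: "real^'d^'d \<Rightarrow> real" and A :: "int \<Rightarrow> real^'d^'d"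
  assumes "matrix_norm N"
    and "\<And>n. invertible (A n)"
    and "bdd_above (range (\<lambda>n. N (A n)))"
    and "bdd_above (range (\<lambda>n. N (matrix_inv (A n))))"
    and "full_spectrum N A"
  shows "diagonalizable N A"
proof -
  let ?X = "fundamental_matrix A" and ?d = "CARD('d)"
  note iff = exponential_dichotomy_scaleR_iff[OF assms(1,2)]
  note X = invertible_fundamental_matrix[of A, OF assms(2)]
  have X0: "?X 0 = mat 1" by (simp add: fundamental_matrix_def)
  obtain a b :: "nat \<Rightarrow> real" where ab: "0 < a 1" "\<forall>i\<in>{1..?d}. a i \<le> b i"
      "\<forall>i\<in>{1..<?d}. b i < a (i + 1)"
    and spec: "dichotomy_spectrum N A = (\<Union>i\<in>{1..?d}. {a i..b i})"
    using assms(5) unfolding full_spectrum_def by blast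
  obtain l where l: "\<And>i. i \<le> ?d \<Longrightarrow> 0 < l i"
    "\<And>i j. i \<le> ?d \<Longrightarrow> 1 \<le> j \<Longrightarrow> j \<le> i \<Longrightarrow> b j < l i"
    "\<And>i j. i < j \<Longrightarrow> j \<le> ?d \<Longrightarrow> l i < a j"
    using interval_gap_points[OF ab] by blast
  have "\<exists>P. dichotomy_at N ?X (l i) P" if "i \<le> ?d" for i
  proof -
    have "l i \<notin> {a j..b j}" if "j \<in> {1..?d}" for j
      using l(2)[of i j] l(3)[of i j] that \<open>i \<le> ?d\<close> by (cases "j \<le> i") auto
    then have "l i \<notin> dichotomy_spectrum N A" unfolding spec by blast
    then show ?thesis using l(1)[OF that] iff by (simp add: dichotomy_spectrum_def)
  qed
  then obtain P where P: "\<And>i. i \<le> ?d \<Longrightarrow> dichotomy_at N ?X (l i) (P i)" by metis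
  have l_less: "l i < l j" if "i < j" "j \<le> ?d" for i j
  proof -
    have "l i < a j" "a j \<le> b j" "b j < l j" using l(2)[of j j] l(3)[OF that] ab(2) that by auto
    then show ?thesis by linarith
  qed
  have PP: "P i ** P j = P (min i j)" if "i \<le> ?d" "j \<le> ?d" for i j
  proof (rule linorder_cases[of i j])
    assume "i = j"
    then show ?thesis using P[OF that(1)] by (auto simp: dichotomy_at_def)
  next
    assume "i < j"
    then show ?thesis using dichotomy_at_nested(2)[OF assms(1) X X0 _ _ P P] that l(1) l_less
      by (simp add: min_def)
  next
    assume "j < i"
    then show ?thesis using dichotomy_at_nested(1)[OF assms(1) X X0 _ _ P P] that l(1) l_less
      by (simp add: min_def)
  qed
  have P_neq: "P i \<noteq> P (i - 1)" if "1 \<le> i" "i \<le> ?d" for i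
  proof
    assume eq: "P i = P (i - 1)"
    have i: "i - 1 \<le> ?d" "i - 1 < i" "i \<in> {1..?d}" using that by auto
    have a: "0 < l (i - 1)" "l (i - 1) < a i" "a i \<le> b i" "b i < l i"
      using l(1)[OF i(1)] l(3)[OF i(2) that(2)] ab(2) i(3) l(2)[OF that(2,1) order_refl] by auto
    have "dichotomy_at N ?X (l (i - 1)) (P i)" unfolding eq by (rule P[OF i(1)])
    \<comment> \<open>The left endpoint \<open>a i\<close> is a spectral point lying between
      \<open>l (i - 1)\<close> and \<open>l i\<close>, so a dichotomy there is a
      contradiction.\<close>
    then have "dichotomy_at N ?X (a i) (P i)"
      using a by - (rule dichotomy_at_between[OF _ _ _ _ P[OF that(2)]], auto)
    moreover have "a i \<in> dichotomy_spectrum N A" unfolding spec using i(3) a(3) by auto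
    ultimately show False using iff[of "a i"] by (auto simp: dichotomy_spectrum_def)
  qed
  \<comment> \<open>Matches the matrix indices with the intervals. Counting from 1 keeps the
    subtraction in \<open>e i - 1\<close> from being truncated.\<close>
  obtain e :: "'d \<Rightarrow> nat" where e: "bij_betw e UNIV {1..?d}"
    using ex_bij_betw_finite_nat[of "UNIV :: 'd set"] ex_bij_betw_nat_finite_1[of "UNIV :: 'd set"]
    by (metis bij_betw_inv finite)
  have e_range: "1 \<le> e i" "e i \<le> ?d" for i using bij_betwE[OF e] by auto
  have e_inj: "e i = e j \<longleftrightarrow> i = j" for i j using bij_betw_imp_inj_on[OF e] by (auto dest: injD)
  define Q where "Q i = P (e i) - P (e i - 1)" for i
  show ?thesis
  proof (rule diagonalizable_if_projections[where X = ?X and Q = Q, OF assms(1)])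
    show "invertible (?X n)" "?X (n + 1) = A n ** ?X n" for n
      by (fact X, rule fundamental_matrix_Suc[OF assms(2)])
    show "Q i \<noteq> 0" for i using P_neq e_range by (simp add: Q_def)
    show "Q i ** Q j = (if i = j then Q i else 0)" for i j
    proof -
      have le: "e i - 1 \<le> ?d" "e j - 1 \<le> ?d" using e_range[of i] e_range[of j] by linarith+
      have "Q i ** Q j = P (min (e i) (e j)) - P (min (e i - 1) (e j))
          - (P (min (e i) (e j - 1)) - P (min (e i - 1) (e j - 1)))"
        unfolding Q_def matrix_mult_bilinear
        by (simp only: PP[OF e_range(2) e_range(2)] PP[OF e_range(2) le(2)] PP[OF le(1) e_range(2)] PP[OF le])
      moreover consider "i = j" | "e i < e j" | "e j < e i" using e_inj[of i j] by linarith
      then have "P (min (e i) (e j)) - P (min (e i - 1) (e j))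
          - (P (min (e i) (e j - 1)) - P (min (e i - 1) (e j - 1))) = (if i = j then Q i else 0)"
      proof cases
        \<comment> \<open>\<open>e i < e j\<close> means \<open>e i \<le> e j - 1\<close>, so
          lowering \<open>e j\<close> by one changes neither minimum and the four terms cancel in
          pairs; the next case is symmetric.\<close>
        case 2
        then have "min (e i) (e j) = min (e i) (e j - 1)" "min (e i - 1) (e j) = min (e i - 1) (e j - 1)"
          by linarith+
        with 2 show ?thesis by auto
      next
        case 3
        then have "min (e i) (e j) = min (e i - 1) (e j)" "min (e i) (e j - 1) = min (e i - 1) (e j - 1)"
          by linarith+
        with 3 show ?thesis by auto
      qed (simp add: Q_def)
      ultimately show ?thesis by simp
    qed
    show "bounded (range (\<lambda>n. ?X n ** Q i ** matrix_inv (?X n)))" for i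
    proof -
      have "e i - 1 \<le> ?d" using e_range[of i] by linarith
      then have "bounded (range (\<lambda>n. ?X n ** P (e i) ** matrix_inv (?X n)))"
        "bounded (range (\<lambda>n. ?X n ** P (e i - 1) ** matrix_inv (?X n)))"
        using dichotomy_at_bounded[OF assms(1) P] e_range by blast+
      from bounded_minus_comp[OF this] show ?thesis
        by (simp add: Q_def matrix_mult_bilinear)
    qed
  qed
qed

end
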